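(* Every forest-skein group contains a copy of Thompson's group $F$. More precisely, let $\mathcal G=\mathrm{ForC}\langle S\mid R\rangle$ be a presented Ore forest-skein category with fraction group $G=\mathrm{Frac}(\mathcal G,1)$ and let $\mathcal{UF}$ be the monochromatic free forest-skein category, whose fraction group is $F$. Then each colour $a\in S$ defines an injective morphism $C_a:\mathcal{UF}\to\mathcal G$, $Y\mapsto Y_a$ (called the colouring map), which extends to an injective group morphism $F\hookrightarrow G$, $[t,s]\mapsto[C_a(t),C_a(s)]$.
   Context: Trees are finite ordered rooted binary trees; $I$ is the trivial tree. A forest is a finite list of trees, with roots and leaves ordered from left to right. A coloured forest over a nonempty set $S$ has each interior (non-leaf) vertex labelled by an element of $S$. If $f$ has as many leaves as $g$ has roots, $f\circ g=fg$ is the stacking of $g$ on top of $f$; $f\otimes g$ is horizontal concatenation. $Y_a$ is the tree with two leaves whose unique interior vertex is coloured by $a$. Given a set $R$ of pairs of coloured trees with the same number of leaves, $\mathrm{ForC}\langle S\mid R\rangle$ is the quotient of the set of coloured forests over $S$ by the smallest equivalence relation containing $R$ and closed under composition and tensor product with forests, a small monoidal category. The monochromatic free forest-skein category $\mathcal{UF}$ is the case where $S$ is a singleton and $R=\emptyset$; $Y$ denotes its unique tree with two leaves. A morphism of forest-skein categories is a map preserving $\circ$, $\otimes$ and the numbers of roots and leaves. A forest-skein category is an Ore category if it is left-cancellative ($fg=fh\Rightarrow g=h$) and for all $f,g$ with the same number of roots there are $p,q$ with $fp=gq$. For an Ore forest-skein category $\mathcal G$, $\mathrm{Frac}(\mathcal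 G,1)$ is the group of classes $[t,s]$ of pairs of trees with the same number of leaves modulo the relation generated by $(t,s)\sim(tf,sf)$, with $[t,s][t',s']=[tp,s'p']$ whenever $sp=t'p'$. A forest-skein group is a group isomorphic to such a $\mathrm{Frac}(\mathcal G,1)$. *)

theory Defs
  imports "HOL-Algebra.Group"
begin

section \<open>Coloured trees and forests\<close>

datatype 'a ctree = Leaf | Node 'a "'a ctree" "'a ctree"

fun nleaves :: "'a ctree \<Rightarrow> nat" where
  "nleaves Leaf = 1"
| "nleaves (Node a l r) = nleaves l + nleaves r"

text \<open>The forest \<open>f\<close> has \<open>length f\<close> roots. The empty forest is allowed; it is the unit of the
  tensor product, which is concatenation of lists.\<close>

type_synonym 'a cforest = "'a ctree list"

definition fleaves :: "'a cforest \<Rightarrow> nat" where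
  "fleaves f = sum_list (map nleaves f)"

text \<open>Both functions below are only meaningful when the list argument has as many trees as the
  other argument has leaves; the trees are then attached to the leaves from left to right.\<close>

fun graft :: "'a ctree \<Rightarrow> 'a cforest \<Rightarrow> 'a ctree" where
  "graft Leaf g = hd g"
| "graft (Node a l r) g = Node a (graft l (take (nleaves l) g)) (graft r (drop (nleaves l) g))"

fun stack :: "'a cforest \<Rightarrow> 'a cforest \<Rightarrow> 'a cforest" where
  "stack [] g = []"
| "stack (t # f) g = graft t (take (nleaves t) g) # stack f (drop (nleaves t) g)"

definition trees_over :: "'a set \<Rightarrow> 'a ctree set" where
  "trees_over S = {t. set_ctree t \<subseteq> S}"

definition forests_over :: "'a set \<Rightarrow> 'a cforest set" where
  "forests_over S = lists (trees_over S)"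

definition skein_presentation :: "'a set \<Rightarrow> ('a ctree \<times> 'a ctree) set \<Rightarrow> bool" where
  "skein_presentation S R \<longleftrightarrow>
     S \<noteq> {} \<and> (\<forall>(t, s) \<in> R. t \<in> trees_over S \<and> s \<in> trees_over S \<and> nleaves t = nleaves s)"

inductive_set skein_rel :: "'a set \<Rightarrow> ('a ctree \<times> 'a ctree) set \<Rightarrow> 'a cforest rel"
  for S :: "'a set" and R :: "('a ctree \<times> 'a ctree) set" where
  base: "(t, s) \<in> R \<Longrightarrow> ([t], [s]) \<in> skein_rel S R"
| refl: "f \<in> forests_over S \<Longrightarrow> (f, f) \<in> skein_rel S R"
| sym: "(f, g) \<in> skein_rel S R \<Longrightarrow> (g, f) \<in> skein_rel S R"
| trans: "(f, g) \<in> skein_rel S R \<Longrightarrow> (g, h) \<in> skein_rel S R \<Longrightarrow> (f, h) \<in> skein_rel S R"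
| stack_left: "(f, g) \<in> skein_rel S R \<Longrightarrow> h \<in> forests_over S \<Longrightarrow> fleaves h = length f
    \<Longrightarrow> (stack h f, stack h g) \<in> skein_rel S R"
| stack_right: "(f, g) \<in> skein_rel S R \<Longrightarrow> h \<in> forests_over S \<Longrightarrow> fleaves f = length h
    \<Longrightarrow> (stack f h, stack g h) \<in> skein_rel S R"
| tensor_left: "(f, g) \<in> skein_rel S R \<Longrightarrow> h \<in> forests_over S
    \<Longrightarrow> (h @ f, h @ g) \<in> skein_rel S R"
| tensor_right: "(f, g) \<in> skein_rel S R \<Longrightarrow> h \<in> forests_over S
    \<Longrightarrow> (f @ h, g @ h) \<in> skein_rel S R"

definition skein_class :: "'a set \<Rightarrow> ('a ctree \<times> 'a ctree) set \<Rightarrow> 'a cforest \<Rightarrow> 'a cforest set" where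
  "skein_class S R f = skein_rel S R `` {f}"


section \<open>Forest-skein categories\<close>

text \<open>The operations of a small monoidal category whose objects are natural numbers; a morphism
  goes from its number of roots to its number of leaves. Composition is written in diagrammatic
  order and is only meaningful when the leaves of the first argument match the roots of the
  second.\<close>

record 'f fcat =
  Mor :: "'f set"
  Roots :: "'f \<Rightarrow> nat"
  Leaves :: "'f \<Rightarrow> nat"
  Comp :: "'f \<Rightarrow> 'f \<Rightarrow> 'f"
  Tensor :: "'f \<Rightarrow> 'f \<Rightarrow> 'f"
  Ident :: "nat \<Rightarrow> 'f"

text \<open>Roots, leaves, composition and tensor product are constant, up to \<open>skein_rel\<close>, on classes,
  so the images and unions below range over a single value.\<close>

definition ForC :: "'a set \<Rightarrow> ('a ctree \<times> 'a ctree) set \<Rightarrow> 'a cforest set fcat" where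
  "ForC S R =
    \<lparr> Mor = forests_over S // skein_rel S R,
      Roots = (\<lambda>A. the_elem (length ` A)),
      Leaves = (\<lambda>A. the_elem (fleaves ` A)),
      Comp = (\<lambda>A B. \<Union>f\<in>A. \<Union>g\<in>B. skein_class S R (stack f g)),
      Tensor = (\<lambda>A B. \<Union>f\<in>A. \<Union>g\<in>B. skein_class S R (f @ g)),
      Ident = (\<lambda>n. skein_class S R (replicate n Leaf)) \<rparr>"

definition caret :: "'a set \<Rightarrow> ('a ctree \<times> 'a ctree) set \<Rightarrow> 'a \<Rightarrow> 'a cforest set" where
  "caret S R a = skein_class S R [Node a Leaf Leaf]"

definition fcat_morphism :: "'f fcat \<Rightarrow> 'g fcat \<Rightarrow> ('f \<Rightarrow> 'g) \<Rightarrow> bool" where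
  "fcat_morphism C D \<phi> \<longleftrightarrow>
     (\<forall>f\<in>Mor C. \<phi> f \<in> Mor D \<and> Roots D (\<phi> f) = Roots C f \<and> Leaves D (\<phi> f) = Leaves C f) \<and>
     (\<forall>f\<in>Mor C. \<forall>g\<in>Mor C. Leaves C f = Roots C g \<longrightarrow> \<phi> (Comp C f g) = Comp D (\<phi> f) (\<phi> g)) \<and>
     (\<forall>f\<in>Mor C. \<forall>g\<in>Mor C. \<phi> (Tensor C f g) = Tensor D (\<phi> f) (\<phi> g))"

definition left_cancellative :: "'f fcat \<Rightarrow> bool" where
  "left_cancellative C \<longleftrightarrow>
     (\<forall>f\<in>Mor C. \<forall>g\<in>Mor C. \<forall>h\<in>Mor C.
        Leaves C f = Roots C g \<and> Leaves C f = Roots C h \<and> Comp C f g = Comp C f h \<longrightarrow> g = h)"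

definition ore_category :: "'f fcat \<Rightarrow> bool" where
  "ore_category C \<longleftrightarrow> left_cancellative C \<and>
     (\<forall>f\<in>Mor C. \<forall>g\<in>Mor C. Roots C f = Roots C g \<longrightarrow>
        (\<exists>p\<in>Mor C. \<exists>q\<in>Mor C. Leaves C f = Roots C p \<and> Leaves C g = Roots C q \<and>
           Comp C f p = Comp C g q))"


section \<open>Fraction groups\<close>

definition tree_pairs :: "'f fcat \<Rightarrow> ('f \<times> 'f) set" where
  "tree_pairs C = {(t, s). t \<in> Mor C \<and> s \<in> Mor C \<and> Roots C t = 1 \<and> Roots C s = 1 \<and>
                           Leaves C t = Leaves C s}"

definition frac_step :: "'f fcat \<Rightarrow> ('f \<times> 'f) rel" where
  "frac_step C = {((t, s), (Comp C t f, Comp C s f)) | t s f.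
                    (t, s) \<in> tree_pairs C \<and> f \<in> Mor C \<and> Roots C f = Leaves C t}"

definition frac_rel :: "'f fcat \<Rightarrow> ('f \<times> 'f) rel" where
  "frac_rel C = (frac_step C \<union> (frac_step C)\<inverse>)\<^sup>* \<inter> (tree_pairs C \<times> tree_pairs C)"

definition frac_class :: "'f fcat \<Rightarrow> 'f \<Rightarrow> 'f \<Rightarrow> ('f \<times> 'f) set" where
  "frac_class C t s = frac_rel C `` {(t, s)}"

text \<open>In an Ore category all the choices in the product below give the same class.\<close>

definition Frac :: "'f fcat \<Rightarrow> ('f \<times> 'f) set monoid" where
  "Frac C =
    \<lparr> carrier = tree_pairs C // frac_rel C,
      mult = (\<lambda>A B. \<Union> {frac_class C (Comp C t p) (Comp C s' p') | t s t' s' p p'.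
                (t, s) \<in> A \<and> (t', s') \<in> B \<and> p \<in> Mor C \<and> p' \<in> Mor C \<and>
                Roots C p = Leaves C s \<and> Roots C p' = Leaves C t' \<and>
                Comp C s p = Comp C t' p'}),
      one = frac_class C (Ident C 1) (Ident C 1) \<rparr>"

text \<open>The first argument fixes the type from which the colours are taken.\<close>

definition forest_skein_group :: "'a itself \<Rightarrow> ('h, 'm) monoid_scheme \<Rightarrow> bool" where
  "forest_skein_group _ H \<longleftrightarrow> group H \<and>
     (\<exists>(S :: 'a set) R. skein_presentation S R \<and> ore_category (ForC S R) \<and> Frac (ForC S R) \<cong> H)"


section \<open>Thompson's group and the colouring maps\<close>

definition UF :: "unit cforest set fcat" where
  "UF = ForC {()} {}"

definition UF_Y :: "unit cforest set" where
  "UF_Y = caret {()} {} ()"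

text \<open>Thompson's group F in its description by pairs of binary trees.\<close>

definition thompson_F :: "(unit cforest set \<times> unit cforest set) set monoid" where
  "thompson_F = Frac UF"

definition colouring_map ::
  "'a set \<Rightarrow> ('a ctree \<times> 'a ctree) set \<Rightarrow> 'a \<Rightarrow> unit cforest set \<Rightarrow> 'a cforest set" where
  "colouring_map S R a A = (\<Union>f\<in>A. skein_class S R (map (map_ctree (\<lambda>_. a)) f))"

end

theory Submission
  imports Defs
begin

text \<open>
  The heart of the matter is a cancellation property on the right. Write \<open>c\<close> for the map that
  paints a monochromatic tree with the colour \<open>a\<close>. If \<open>t\<close> and \<open>s\<close> are monochromatic trees with
  the same number of leaves and \<open>c(t) f = c(s) f\<close> holds in the forest-skein category for some
  coloured forest \<open>f\<close>, then \<open>t = s\<close> (\<open>colour_tree_cancel\<close>). To see this, strip a common root caret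
  off both sides by left cancellation. Since the defining relations identify trees only, equality
  of two forests in the category means equality tree by tree (\<open>components_if_skein_rel\<close>), so the
  left subtrees agree after grafting an initial segment of \<open>f\<close> onto each of them, and likewise the
  right subtrees with final segments. A longer initial segment of \<open>f\<close> has strictly more leaves,
  and the number of leaves is an invariant, so both sides use the same segment. Hence the
  left subtrees of \<open>t\<close> and \<open>s\<close> have equally many leaves, the same is true on the right, and
  induction applies.

  With \<open>f\<close> trivial this gives the injectivity of the colouring map. For fraction groups it is
  needed for arbitrary \<open>f\<close>: by a common multiple in the free category, two elements of
  Thompson's group can be written \<open>[x,y]\<close> and \<open>[z,y]\<close>, and equality of their images says that
  \<open>c(x) f = c(z) g\<close> and \<open>c(y) f = c(y) g\<close> for some \<open>f\<close>, \<open>g\<close>; left cancellation gives \<open>f = g\<close>,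
  hence \<open>x = z\<close> (\<open>frac_hom_injective\<close>).

  The rest is the calculus of fractions. In an Ore category any two pairs of trees have
  extensions that match, so a product can always be brought into the form
  \<open>[x,y][y,z] = [x,z]\<close> (\<open>Frac_mult\<close>), from which the group axioms and the homomorphism property
  are immediate. The free category is an Ore category because stacking onto a given forest
  determines the forest on top, and any two binary trees have a common refinement.
\<close>

section \<open>Fraction groups of Ore categories\<close>

definition arr :: "'f fcat \<Rightarrow> nat \<Rightarrow> nat \<Rightarrow> 'f \<Rightarrow> bool" where
  "arr C m n f \<longleftrightarrow> f \<in> Mor C \<and> Roots C f = m \<and> Leaves C f = n"

lemma tree_pairs_iff: "(t, s) \<in> tree_pairs C \<longleftrightarrow> (\<exists>n. arr C 1 n t \<and> arr C 1 n s)"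
  by (auto simp: tree_pairs_def arr_def)

text \<open>
  The calculus of fractions takes place in a category on the natural numbers, with the morphisms
  out of \<open>1\<close> in the place of the trees; it is then applied both to the free category and to a
  presented one.
\<close>

locale ore_cat =
  fixes C :: "'f fcat"
  assumes arr_comp: "\<And>m n k f g. arr C m n f \<Longrightarrow> arr C n k g \<Longrightarrow> arr C m k (Comp C f g)"
    and comp_assoc: "\<And>m n k l f g h. arr C m n f \<Longrightarrow> arr C n k g \<Longrightarrow> arr C k l h \<Longrightarrow>
        Comp C (Comp C f g) h = Comp C f (Comp C g h)"
    and arr_ident: "\<And>n. arr C n n (Ident C n)"
    and ident_comp: "\<And>m n f. arr C m n f \<Longrightarrow> Comp C (Ident C m) f = f"
    and comp_ident: "\<And>m n f. arr C m n f \<Longrightarrow> Comp C f (Ident C n) = f"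
    and ore: "ore_category C"
begin

abbreviation comp (infixl "\<cdot>" 70) where "f \<cdot> g \<equiv> Comp C f g"

lemma left_cancel:
  assumes "arr C m n f" "arr C n k g" "arr C n l h" "f \<cdot> g = f \<cdot> h"
  shows "g = h"
proof -
  have "left_cancellative C" using ore by (simp add: ore_category_def)
  then show ?thesis using assms unfolding left_cancellative_def arr_def by auto
qed

lemma common_multiple:
  assumes "arr C m n f" "arr C m k g"
  obtains l p q where "arr C n l p" "arr C k l q" "f \<cdot> p = g \<cdot> q"
proof -
  have "f \<in> Mor C" "g \<in> Mor C" "Roots C f = Roots C g" using assms by (simp_all add: arr_def)
  moreover have "\<forall>f\<in>Mor C. \<forall>g\<in>Mor C. Roots C f = Roots C g \<longrightarrow>
        (\<exists>p\<in>Mor C. \<exists>q\<in>Mor C. Leaves C f = Roots C p \<and> Leaves C g = Roots C q \<and> f \<cdot> p = g \<cdot> q)"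
    using ore by (simp add: ore_category_def)
  ultimately obtain p q where pq: "p \<in> Mor C" "q \<in> Mor C" "Leaves C f = Roots C p"
    "Leaves C g = Roots C q" "f \<cdot> p = g \<cdot> q"
    by blast
  have p: "arr C n (Leaves C p) p" and q: "arr C k (Leaves C q) q"
    using pq assms by (auto simp: arr_def)
  have "Leaves C p = Leaves C q"
    using arr_comp[OF assms(1) p] arr_comp[OF assms(2) q] pq(5) by (simp add: arr_def)
  with q have "arr C k (Leaves C p) q" by simp
  then show ?thesis using that p pq(5) by blast
qed

text \<open>
  Two pairs are equal as fractions when they can be extended to the same pair. Unlike the zigzags
  that generate \<open>frac_rel\<close>, this is a single diagram; \<open>frac_rel_iff\<close> shows that it suffices.
\<close>

definition common_ext :: "'f \<times> 'f \<Rightarrow> 'f \<times> 'f \<Rightarrow> bool" where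
  "common_ext x y \<longleftrightarrow> (\<exists>m n k f g.
     arr C 1 m (fst x) \<and> arr C 1 m (snd x) \<and> arr C 1 n (fst y) \<and> arr C 1 n (snd y) \<and>
     arr C m k f \<and> arr C n k g \<and> fst x \<cdot> f = fst y \<cdot> g \<and> snd x \<cdot> f = snd y \<cdot> g)"

lemma common_extI:
  assumes "arr C 1 m t" "arr C 1 m s" "arr C 1 n t'" "arr C 1 n s'" "arr C m k f" "arr C n k g"
    "t \<cdot> f = t' \<cdot> g" "s \<cdot> f = s' \<cdot> g"
  shows "common_ext (t, s) (t', s')"
  unfolding common_ext_def fst_conv snd_conv using assms by blast

lemma common_extE:
  assumes "common_ext (t, s) (t', s')"
  obtains m n k f g where "arr C 1 m t" "arr C 1 m s" "arr C 1 n t'" "arr C 1 n s'"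
    "arr C m k f" "arr C n k g" "t \<cdot> f = t' \<cdot> g" "s \<cdot> f = s' \<cdot> g"
  using assms unfolding common_ext_def fst_conv snd_conv by blast

lemma common_ext_refl: "x \<in> tree_pairs C \<Longrightarrow> common_ext x x"
proof (cases x)
  case (Pair t s)
  assume "x \<in> tree_pairs C"
  then obtain n where "arr C 1 n t" "arr C 1 n s" unfolding Pair tree_pairs_iff by blast
  then show ?thesis
    unfolding Pair using common_extI[OF _ _ _ _ arr_ident arr_ident] by blast
qed

lemma common_ext_sym: "common_ext x y \<Longrightarrow> common_ext y x"
proof -
  assume "common_ext x y"
  then obtain m n k f g where "arr C 1 m (fst x)" "arr C 1 m (snd x)" "arr C 1 n (fst y)"
    "arr C 1 n (snd y)" "arr C m k f" "arr C n k g" "fst x \<cdot> f = fst y \<cdot> g" "snd x \<cdot> f = snd y \<cdot> g"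
    unfolding common_ext_def by blast
  then show ?thesis
    using common_extI[of n "fst y" "snd y" m "fst x" "snd x" k g f] by simp
qed

text \<open>
  The extensions of the middle pair on either side have a common multiple, and extending everything
  by it makes the two diagrams meet.
\<close>

lemma common_ext_trans:
  assumes "common_ext (t, s) (t', s')" "common_ext (t', s') (t'', s'')"
  shows "common_ext (t, s) (t'', s'')"
proof -
  obtain m n k f g where 1: "arr C 1 m t" "arr C 1 m s" "arr C 1 n t'" "arr C 1 n s'"
    "arr C m k f" "arr C n k g" "t \<cdot> f = t' \<cdot> g" "s \<cdot> f = s' \<cdot> g"
    using assms(1) by (rule common_extE)
  obtain n' m' k' f' g' where 2: "arr C 1 n' t'" "arr C 1 n' s'" "arr C 1 m' t''" "arr C 1 m' s''"
    "arr C n' k' f'" "arr C m' k' g'" "t' \<cdot> f' = t'' \<cdot> g'" "s' \<cdot> f' = s'' \<cdot> g'"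
    using assms(2) by (rule common_extE)
  have n': "n' = n" using 1(3) 2(1) by (simp add: arr_def)
  obtain l p q where pq: "arr C k l p" "arr C k' l q" "g \<cdot> p = f' \<cdot> q"
    using common_multiple[OF 1(6) 2(5)[unfolded n']] .
  have mid: "a \<cdot> (f \<cdot> p) = c \<cdot> (g' \<cdot> q)"
    if a: "arr C 1 m a" and b: "arr C 1 n b" and c: "arr C 1 m' c" and "a \<cdot> f = b \<cdot> g" "b \<cdot> f' = c \<cdot> g'"
    for a b c
  proof -
    have "a \<cdot> (f \<cdot> p) = b \<cdot> g \<cdot> p" using comp_assoc[OF a 1(5) pq(1)] that by simp
    also have "\<dots> = b \<cdot> f' \<cdot> q"
      using comp_assoc[OF b 1(6) pq(1)] comp_assoc[OF b 2(5)[unfolded n'] pq(2)] pq(3) by simp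
    also have "\<dots> = c \<cdot> (g' \<cdot> q)" using comp_assoc[OF c 2(6) pq(2)] that by simp
    finally show ?thesis .
  qed
  show ?thesis
    using common_extI[OF 1(1,2) 2(3,4) arr_comp[OF 1(5) pq(1)] arr_comp[OF 2(6) pq(2)]]
      mid[OF 1(1,3) 2(3) 1(7) 2(7)] mid[OF 1(2,4) 2(4) 1(8) 2(8)] by blast
qed

lemma frac_step_common_ext:
  assumes "(x, y) \<in> frac_step C"
  shows "common_ext x y"
proof -
  obtain t s f where *: "x = (t, s)" "y = (t \<cdot> f, s \<cdot> f)" "(t, s) \<in> tree_pairs C" "f \<in> Mor C"
    "Roots C f = Leaves C t"
    using assms unfolding frac_step_def by blast
  from *(3) obtain n where n: "arr C 1 n t" "arr C 1 n s" unfolding tree_pairs_iff by blast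
  have f: "arr C n (Leaves C f) f" using * n by (simp add: arr_def)
  show ?thesis unfolding * using n f arr_comp[OF n(1) f] arr_comp[OF n(2) f]
    by (intro common_extI[OF n _ _ f arr_ident]) (auto simp: comp_ident)
qed

lemma frac_stepI:
  assumes "arr C 1 n t" "arr C 1 n s" "arr C n k f"
  shows "((t, s), (t \<cdot> f, s \<cdot> f)) \<in> frac_step C"
  using assms unfolding frac_step_def tree_pairs_def arr_def by auto

lemma common_ext_tree_pairs: "common_ext x y \<Longrightarrow> x \<in> tree_pairs C \<and> y \<in> tree_pairs C"
proof -
  assume "common_ext x y"
  then obtain m n where *: "arr C 1 m (fst x)" "arr C 1 m (snd x)" "arr C 1 n (fst y)"
    "arr C 1 n (snd y)"
    unfolding common_ext_def by blast
  have "(fst x, snd x) \<in> tree_pairs C" "(fst y, snd y) \<in> tree_pairs C"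
    unfolding tree_pairs_iff using * by blast+
  then show ?thesis by simp
qed

lemma frac_rel_iff: "(x, y) \<in> frac_rel C \<longleftrightarrow> common_ext x y"
proof
  assume "(x, y) \<in> frac_rel C"
  then have "x \<in> tree_pairs C" "(x, y) \<in> (frac_step C \<union> (frac_step C)\<inverse>)\<^sup>*"
    by (auto simp: frac_rel_def)
  from this(2) show "common_ext x y"
  proof (induction rule: rtrancl_induct)
    case base
    show ?case using \<open>x \<in> tree_pairs C\<close> by (rule common_ext_refl)
  next
    case (step y z)
    have "common_ext y z" using step(2) frac_step_common_ext common_ext_sym by blast
    with step(3) show ?case
      by (metis common_ext_trans surj_pair)
  qed
next
  assume c: "common_ext x y"
  obtain t s t' s' where xy: "x = (t, s)" "y = (t', s')" by (metis surj_pair)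
  obtain m n k f g where 1: "arr C 1 m t" "arr C 1 m s" "arr C 1 n t'" "arr C 1 n s'"
    "arr C m k f" "arr C n k g" "t \<cdot> f = t' \<cdot> g" "s \<cdot> f = s' \<cdot> g"
    using c unfolding xy by (rule common_extE)
  have "(x, (t \<cdot> f, s \<cdot> f)) \<in> frac_step C" "(y, (t \<cdot> f, s \<cdot> f)) \<in> frac_step C"
    using frac_stepI[OF 1(1,2,5)] frac_stepI[OF 1(3,4,6)] 1(7,8) xy by simp_all
  then have "(x, y) \<in> (frac_step C \<union> (frac_step C)\<inverse>)\<^sup>*"
    by (meson UnCI converseI converse_rtrancl_into_rtrancl r_into_rtrancl)
  then show "(x, y) \<in> frac_rel C"
    using common_ext_tree_pairs[OF c] by (simp add: frac_rel_def)
qed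

lemma equiv_frac_rel: "equiv (tree_pairs C) (frac_rel C)"
proof (rule equivI)
  show "frac_rel C \<subseteq> tree_pairs C \<times> tree_pairs C" by (auto simp: frac_rel_def)
  show "refl_on (tree_pairs C) (frac_rel C)"
    by (rule refl_onI) (auto simp: frac_rel_iff common_ext_refl)
  show "sym (frac_rel C)" by (rule symI) (simp add: frac_rel_iff common_ext_sym)
  show "trans (frac_rel C)"
    by (rule transI) (metis frac_rel_iff common_ext_trans surj_pair)
qed

lemma frac_class_eq_iff:
  assumes "arr C 1 m t" "arr C 1 m s" "arr C 1 n t'" "arr C 1 n s'"
  shows "frac_class C t s = frac_class C t' s' \<longleftrightarrow> common_ext (t, s) (t', s')"
  unfolding frac_class_def frac_rel_iff[symmetric]
  by (rule eq_equiv_class_iff[OF equiv_frac_rel]) (use assms in \<open>auto simp: tree_pairs_iff\<close>)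

lemma frac_class_mem: "x \<in> frac_class C t s \<longleftrightarrow> common_ext (t, s) x"
  by (simp add: frac_class_def frac_rel_iff)

lemma frac_class_extend:
  assumes "arr C 1 n t" "arr C 1 n s" "arr C n k f"
  shows "frac_class C (t \<cdot> f) (s \<cdot> f) = frac_class C t s"
proof -
  have "common_ext (t, s) (t \<cdot> f, s \<cdot> f)"
    using frac_stepI[OF assms] by (rule frac_step_common_ext)
  then show ?thesis
    using frac_class_eq_iff[OF assms(1,2) arr_comp[OF assms(1,3)] arr_comp[OF assms(2,3)]] by simp
qed

lemma frac_class_diag:
  assumes "arr C 1 n t"
  shows "frac_class C t t = one (Frac C)"
  using frac_class_extend[OF arr_ident arr_ident assms] ident_comp[OF assms]
  by (simp add: Frac_def)

lemma carrier_FracI: "arr C 1 n t \<Longrightarrow> arr C 1 n s \<Longrightarrow> frac_class C t s \<in> carrier (Frac C)"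
  unfolding Frac_def frac_class_def partial_object.simps
  by (rule quotientI) (auto simp: tree_pairs_iff)

lemma carrier_FracE:
  assumes "A \<in> carrier (Frac C)"
  obtains n t s where "arr C 1 n t" "arr C 1 n s" "A = frac_class C t s"
proof -
  from assms obtain x where "x \<in> tree_pairs C" "A = frac_rel C `` {x}"
    unfolding Frac_def by (auto elim: quotientE)
  then show ?thesis
    using that unfolding frac_class_def by (cases x) (auto simp: tree_pairs_iff)
qed

text \<open>
  Equal fractions are extended in lockstep: if two extensions agree on the numerators, then they
  agree on the denominators up to a further extension. This is where left cancellation enters, in
  order to compare the given extensions with those that witness the equality of fractions.
\<close>

lemma common_ext_transfer:
  assumes "common_ext (t, s) (t', s')" "arr C 1 m t" "arr C 1 n t'" "arr C m k x" "arr C n k y"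
    and eq: "t \<cdot> x = t' \<cdot> y"
  obtains l a where "arr C k l a" "s \<cdot> x \<cdot> a = s' \<cdot> y \<cdot> a"
proof -
  obtain m' n' j f g where 1: "arr C 1 m' t" "arr C 1 m' s" "arr C 1 n' t'" "arr C 1 n' s'"
    "arr C m' j f" "arr C n' j g" "t \<cdot> f = t' \<cdot> g" "s \<cdot> f = s' \<cdot> g"
    using assms(1) by (rule common_extE)
  have [simp]: "m' = m" "n' = n" using 1 assms by (auto simp: arr_def)
  note 1 = 1[simplified]
  obtain l a b where ab: "arr C k l a" "arr C j l b" "x \<cdot> a = f \<cdot> b"
    using common_multiple[OF assms(4) 1(5)] .
  have "t' \<cdot> (y \<cdot> a) = t \<cdot> (x \<cdot> a)"
    using comp_assoc[OF assms(3,5) ab(1)] comp_assoc[OF assms(2,4) ab(1)] eq by simp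
  also have "\<dots> = t' \<cdot> (g \<cdot> b)"
    using comp_assoc[OF 1(1,5) ab(2)] comp_assoc[OF 1(3,6) ab(2)] 1(7) ab(3) by simp
  finally have ya: "y \<cdot> a = g \<cdot> b"
    by (rule left_cancel[OF assms(3) arr_comp[OF assms(5) ab(1)] arr_comp[OF 1(6) ab(2)]])
  have "s \<cdot> x \<cdot> a = s \<cdot> f \<cdot> b"
    using comp_assoc[OF 1(2) assms(4) ab(1)] comp_assoc[OF 1(2,5) ab(2)] ab(3) by simp
  also have "\<dots> = s' \<cdot> y \<cdot> a"
    using comp_assoc[OF 1(4) assms(5) ab(1)] comp_assoc[OF 1(4,6) ab(2)] ya 1(8) by simp
  finally show ?thesis using that ab(1) by blast
qed

text \<open>
  Well-definedness of the product, with one factorisation \<open>[a,b]\<close>, \<open>[b,c]\<close> taken as the reference.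
  Starting from a common multiple of \<open>a\<close> and \<open>tp\<close>, the lockstep property is applied to the first
  fraction, passing from \<open>a\<close> and \<open>t\<close> to \<open>b\<close> and \<open>s\<close>; since \<open>sp = t'p'\<close>, it then
  applies to the second fraction, passing from \<open>b\<close> and \<open>t'\<close> to \<open>c\<close> and \<open>s'\<close>.
\<close>

lemma frac_mult_independent:
  assumes "common_ext (a, b) (t, s)" "common_ext (b, c) (t', s')" "arr C 1 n a" "arr C 1 n b" "arr C 1 n c"
    "p \<in> Mor C" "p' \<in> Mor C" "Roots C p = Leaves C s" "Roots C p' = Leaves C t'" "s \<cdot> p = t' \<cdot> p'"
  shows "frac_class C (t \<cdot> p) (s' \<cdot> p') = frac_class C a c"
proof -
  obtain m where 1: "arr C 1 m t" "arr C 1 m s"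
    using common_ext_tree_pairs[OF assms(1)] unfolding tree_pairs_iff by blast
  obtain m' where 2: "arr C 1 m' t'" "arr C 1 m' s'"
    using common_ext_tree_pairs[OF assms(2)] unfolding tree_pairs_iff by blast
  define k where "k = Leaves C p"
  have p: "arr C m k p" using assms(6,8) 1 by (simp add: arr_def k_def)
  have "arr C m' (Leaves C p') p'" using assms(7,9) 2 by (simp add: arr_def)
  then have p': "arr C m' k p'"
    using arr_comp[OF 1(2) p] arr_comp[OF 2(1), of _ p'] assms(10) by (simp add: arr_def)
  obtain l x y where xy: "arr C n l x" "arr C k l y" "a \<cdot> x = t \<cdot> p \<cdot> y"
    using common_multiple[OF assms(3) arr_comp[OF 1(1) p]] .
  note py = arr_comp[OF p xy(2)] and p'y = arr_comp[OF p' xy(2)]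
  have "a \<cdot> x = t \<cdot> (p \<cdot> y)" using xy(3) comp_assoc[OF 1(1) p xy(2)] by simp
  then obtain l' u where u: "arr C l l' u" "b \<cdot> x \<cdot> u = s \<cdot> (p \<cdot> y) \<cdot> u"
    by (rule common_ext_transfer[OF assms(1,3) 1(1) xy(1) py])
  note xu = arr_comp[OF xy(1) u(1)] and yu = arr_comp[OF p'y u(1)] and yu' = arr_comp[OF xy(2) u(1)]
  have "b \<cdot> (x \<cdot> u) = t' \<cdot> (p' \<cdot> y \<cdot> u)"
  proof -
    have "b \<cdot> (x \<cdot> u) = s \<cdot> p \<cdot> y \<cdot> u"
      using comp_assoc[OF assms(4) xy(1) u(1)] u(2) comp_assoc[OF 1(2) p xy(2)] by simp
    also have "\<dots> = t' \<cdot> (p' \<cdot> y \<cdot> u)"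
      using assms(10) comp_assoc[OF 2(1) p' xy(2)] comp_assoc[OF 2(1) p'y u(1)] by simp
    finally show ?thesis .
  qed
  then obtain l'' v where v: "arr C l' l'' v" "c \<cdot> (x \<cdot> u) \<cdot> v = s' \<cdot> (p' \<cdot> y \<cdot> u) \<cdot> v"
    by (rule common_ext_transfer[OF assms(2,4) 2(1) xu yu])
  note xuv = arr_comp[OF xu v(1)] and yuv = arr_comp[OF yu' v(1)]
  have "a \<cdot> (x \<cdot> u \<cdot> v) = t \<cdot> p \<cdot> (y \<cdot> u \<cdot> v)"
    using comp_assoc[OF assms(3) xu v(1)] comp_assoc[OF assms(3) xy(1) u(1)] xy(3)
      comp_assoc[OF arr_comp[OF 1(1) p] yu' v(1)] comp_assoc[OF arr_comp[OF 1(1) p] xy(2) u(1)]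
    by simp
  moreover have "c \<cdot> (x \<cdot> u \<cdot> v) = s' \<cdot> p' \<cdot> (y \<cdot> u \<cdot> v)"
    using comp_assoc[OF assms(5) xu v(1)] v(2) comp_assoc[OF 2(2) yu v(1)]
      comp_assoc[OF p' xy(2) u(1)] comp_assoc[OF p' yu' v(1)] comp_assoc[OF 2(2) p' yuv]
    by simp
  ultimately have "common_ext (a, c) (t \<cdot> p, s' \<cdot> p')"
    using common_extI[OF assms(3,5) arr_comp[OF 1(1) p] arr_comp[OF 2(2) p'] xuv yuv] by blast
  then show ?thesis
    using frac_class_eq_iff[OF assms(3,5) arr_comp[OF 1(1) p] arr_comp[OF 2(2) p']] by simp
qed

lemma Frac_mult:
  assumes "arr C 1 n a" "arr C 1 n b" "arr C 1 n c"
  shows "frac_class C a b \<otimes>\<^bsub>Frac C\<^esub> frac_class C b c = frac_class C a c"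
proof -
  let ?X = "{frac_class C (t \<cdot> p) (s' \<cdot> p') | t s t' s' p p'.
                (t, s) \<in> frac_class C a b \<and> (t', s') \<in> frac_class C b c \<and> p \<in> Mor C \<and> p' \<in> Mor C \<and>
                Roots C p = Leaves C s \<and> Roots C p' = Leaves C t' \<and> s \<cdot> p = t' \<cdot> p'}"
  have "?X \<subseteq> {frac_class C a c}"
  proof (rule subsetI)
    fix Z assume "Z \<in> ?X"
    then obtain t s t' s' p p' where Z: "Z = frac_class C (t \<cdot> p) (s' \<cdot> p')"
      "common_ext (a, b) (t, s)" "common_ext (b, c) (t', s')" "p \<in> Mor C" "p' \<in> Mor C"
      "Roots C p = Leaves C s" "Roots C p' = Leaves C t'" "s \<cdot> p = t' \<cdot> p'"
      unfolding frac_class_mem by blast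
    show "Z \<in> {frac_class C a c}"
      unfolding Z(1) using frac_mult_independent[OF Z(2,3) assms Z(4-8)] by simp
  qed
  moreover have "frac_class C a c \<in> ?X"
  proof -
    have 1: "(a, b) \<in> frac_class C a b" "(b, c) \<in> frac_class C b c"
      using assms unfolding frac_class_mem by (blast intro: common_ext_refl tree_pairs_iff[THEN iffD2])+
    have 2: "a \<cdot> Ident C n = a" "c \<cdot> Ident C n = c"
      using assms comp_ident by blast+
    have 3: "Ident C n \<in> Mor C" "Roots C (Ident C n) = Leaves C b"
      using arr_ident[of n] assms(2) by (simp_all add: arr_def)
    have "frac_class C (a \<cdot> Ident C n) (c \<cdot> Ident C n) \<in> ?X"
      using 1 3 by blast
    then show ?thesis unfolding 2 .
  qed
  ultimately have "?X = {frac_class C a c}" by blast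
  then show ?thesis by (simp add: Frac_def)
qed

text \<open>
  Extending the denominator of one fraction and the numerator of the next to a common multiple
  puts them into the shape to which \<open>Frac_mult\<close> applies; associativity needs three in a row.
\<close>

lemma two_fractions:
  assumes "A \<in> carrier (Frac C)" "B \<in> carrier (Frac C)"
  obtains n a b c where "arr C 1 n a" "arr C 1 n b" "arr C 1 n c"
    "A = frac_class C a b" "B = frac_class C b c"
proof -
  obtain m t s where 1: "arr C 1 m t" "arr C 1 m s" "A = frac_class C t s"
    using assms(1) by (rule carrier_FracE)
  obtain m' t' s' where 2: "arr C 1 m' t'" "arr C 1 m' s'" "B = frac_class C t' s'"
    using assms(2) by (rule carrier_FracE)
  obtain l p q where pq: "arr C m l p" "arr C m' l q" "s \<cdot> p = t' \<cdot> q"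
    using common_multiple[OF 1(2) 2(1)] .
  show ?thesis
  proof (rule that)
    show "arr C 1 l (t \<cdot> p)" "arr C 1 l (s \<cdot> p)" "arr C 1 l (s' \<cdot> q)"
      using arr_comp[OF 1(1) pq(1)] arr_comp[OF 1(2) pq(1)] arr_comp[OF 2(2) pq(2)] .
    show "A = frac_class C (t \<cdot> p) (s \<cdot> p)" "B = frac_class C (s \<cdot> p) (s' \<cdot> q)"
      using frac_class_extend[OF 1(1,2) pq(1)] frac_class_extend[OF 2(1,2) pq(2)] 1 2 pq(3)
      by simp_all
  qed
qed

lemma three_fractions:
  assumes "A \<in> carrier (Frac C)" "B \<in> carrier (Frac C)" "D \<in> carrier (Frac C)"
  obtains n a b c d where "arr C 1 n a" "arr C 1 n b" "arr C 1 n c" "arr C 1 n d"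
    "A = frac_class C a b" "B = frac_class C b c" "D = frac_class C c d"
proof -
  obtain m a b c where 1: "arr C 1 m a" "arr C 1 m b" "arr C 1 m c"
    "A = frac_class C a b" "B = frac_class C b c"
    using two_fractions[OF assms(1,2)] .
  obtain m' t s where 2: "arr C 1 m' t" "arr C 1 m' s" "D = frac_class C t s"
    using assms(3) by (rule carrier_FracE)
  obtain l p q where pq: "arr C m l p" "arr C m' l q" "c \<cdot> p = t \<cdot> q"
    using common_multiple[OF 1(3) 2(1)] .
  show ?thesis
  proof (rule that)
    show "arr C 1 l (a \<cdot> p)" "arr C 1 l (b \<cdot> p)" "arr C 1 l (c \<cdot> p)" "arr C 1 l (s \<cdot> q)"
      using arr_comp[OF 1(1) pq(1)] arr_comp[OF 1(2) pq(1)] arr_comp[OF 1(3) pq(1)]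
        arr_comp[OF 2(2) pq(2)] .
    show "A = frac_class C (a \<cdot> p) (b \<cdot> p)" "B = frac_class C (b \<cdot> p) (c \<cdot> p)"
      "D = frac_class C (c \<cdot> p) (s \<cdot> q)"
      using frac_class_extend[OF 1(1,2) pq(1)] frac_class_extend[OF 1(2,3) pq(1)]
        frac_class_extend[OF 2(1,2) pq(2)] 1 2 pq(3) by simp_all
  qed
qed

lemma group_Frac: "group (Frac C)"
proof (rule groupI)
  fix A B assume "A \<in> carrier (Frac C)" "B \<in> carrier (Frac C)"
  then obtain n a b c where *: "arr C 1 n a" "arr C 1 n b" "arr C 1 n c"
    "A = frac_class C a b" "B = frac_class C b c"
    by (rule two_fractions)
  show "A \<otimes>\<^bsub>Frac C\<^esub> B \<in> carrier (Frac C)"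
    unfolding *(4,5) Frac_mult[OF *(1-3)] using *(1,3) by (rule carrier_FracI)
next
  show "\<one>\<^bsub>Frac C\<^esub> \<in> carrier (Frac C)"
    using carrier_FracI[OF arr_ident arr_ident] by (simp add: Frac_def)
next
  fix A B D assume "A \<in> carrier (Frac C)" "B \<in> carrier (Frac C)" "D \<in> carrier (Frac C)"
  then obtain n a b c d where *: "arr C 1 n a" "arr C 1 n b" "arr C 1 n c" "arr C 1 n d"
    "A = frac_class C a b" "B = frac_class C b c" "D = frac_class C c d"
    by (rule three_fractions)
  show "A \<otimes>\<^bsub>Frac C\<^esub> B \<otimes>\<^bsub>Frac C\<^esub> D = A \<otimes>\<^bsub>Frac C\<^esub> (B \<otimes>\<^bsub>Frac C\<^esub> D)"
    unfolding *(5-7) using *(1-4) by (simp add: Frac_mult)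
next
  fix A assume "A \<in> carrier (Frac C)"
  then obtain n t s where *: "arr C 1 n t" "arr C 1 n s" "A = frac_class C t s"
    by (rule carrier_FracE)
  show "\<one>\<^bsub>Frac C\<^esub> \<otimes>\<^bsub>Frac C\<^esub> A = A"
    unfolding frac_class_diag[OF *(1), symmetric] *(3) using * by (simp add: Frac_mult)
  show "\<exists>B\<in>carrier (Frac C). B \<otimes>\<^bsub>Frac C\<^esub> A = \<one>\<^bsub>Frac C\<^esub>"
    using carrier_FracI[OF *(2,1)] Frac_mult[OF *(2,1,2)] frac_class_diag[OF *(2)] *(3) by auto
qed

end

text \<open>
  A morphism carries the diagram of a common extension to another such diagram, and the product
  \<open>[x,y][y,z] = [x,z]\<close> to a product of the same form.
\<close>

lemma frac_hom:
  assumes C: "ore_cat C" and D: "ore_cat D" and phi: "fcat_morphism C D \<phi>"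
  obtains \<theta> where "group_hom (Frac C) (Frac D) \<theta>"
    "\<And>t s. (t, s) \<in> tree_pairs C \<Longrightarrow> \<theta> (frac_class C t s) = frac_class D (\<phi> t) (\<phi> s)"
proof -
  interpret C: ore_cat C by fact
  interpret D: ore_cat D by fact
  have arr: "arr D m n (\<phi> f)" if "arr C m n f" for m n f
    using phi that by (simp add: fcat_morphism_def arr_def)
  have comp: "\<phi> (Comp C f g) = Comp D (\<phi> f) (\<phi> g)" if "arr C m n f" "arr C n k g" for m n k f g
    using phi that by (simp add: fcat_morphism_def arr_def)
  define \<theta> where "\<theta> A = (\<Union>(t, s)\<in>A. frac_class D (\<phi> t) (\<phi> s))" for A
  have theta: "\<theta> (frac_class C t s) = frac_class D (\<phi> t) (\<phi> s)"
    if ts: "arr C 1 n t" "arr C 1 n s" for n t s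
  proof -
    have indep: "frac_class D (\<phi> t') (\<phi> s') = frac_class D (\<phi> t) (\<phi> s)"
      if ext: "C.common_ext (t, s) (t', s')" for t' s'
    proof -
      obtain m n k f g where 1: "arr C 1 m t" "arr C 1 m s" "arr C 1 n t'" "arr C 1 n s'"
        "arr C m k f" "arr C n k g" "Comp C t f = Comp C t' g" "Comp C s f = Comp C s' g"
        using ext by (rule C.common_extE)
      have "D.common_ext (\<phi> t, \<phi> s) (\<phi> t', \<phi> s')"
        using 1 by (intro D.common_extI[of m _ _ n _ _ k "\<phi> f" "\<phi> g"] arr) (metis comp)+
      then show ?thesis
        using D.frac_class_eq_iff[OF arr[OF 1(1)] arr[OF 1(2)] arr[OF 1(3)] arr[OF 1(4)]] by simp
    qed
    have self: "C.common_ext (t, s) (t, s)"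
      using ts by (auto intro!: C.common_ext_refl simp: tree_pairs_iff)
    have const: "(case x of (t', s') \<Rightarrow> frac_class D (\<phi> t') (\<phi> s')) = frac_class D (\<phi> t) (\<phi> s)"
      if "x \<in> frac_class C t s" for x
      using that indep by (cases x) (simp add: C.frac_class_mem)
    have "\<theta> (frac_class C t s) = (\<Union>x\<in>frac_class C t s. frac_class D (\<phi> t) (\<phi> s))"
      unfolding \<theta>_def by (rule SUP_cong[OF HOL.refl const])
    moreover have "frac_class C t s \<noteq> {}" using self C.frac_class_mem by blast
    ultimately show ?thesis by simp
  qed
  have "\<theta> \<in> hom (Frac C) (Frac D)"
  proof (rule homI)
    fix A assume "A \<in> carrier (Frac C)"
    then obtain n t s where "arr C 1 n t" "arr C 1 n s" "A = frac_class C t s"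
      by (rule C.carrier_FracE)
    then show "\<theta> A \<in> carrier (Frac D)" by (metis theta D.carrier_FracI arr)
  next
    fix A B assume "A \<in> carrier (Frac C)" "B \<in> carrier (Frac C)"
    then obtain n a b c where *: "arr C 1 n a" "arr C 1 n b" "arr C 1 n c"
      "A = frac_class C a b" "B = frac_class C b c"
      by (rule C.two_fractions)
    show "\<theta> (A \<otimes>\<^bsub>Frac C\<^esub> B) = \<theta> A \<otimes>\<^bsub>Frac D\<^esub> \<theta> B"
      unfolding *(4,5) C.Frac_mult[OF *(1-3)] theta[OF *(1,2)] theta[OF *(2,3)] theta[OF *(1,3)]
      by (rule D.Frac_mult[symmetric]) (use * arr in auto)
  qed
  then have "group_hom (Frac C) (Frac D) \<theta>"
    by (intro group_hom.intro group_hom_axioms.intro C.group_Frac D.group_Frac)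
  moreover have "\<theta> (frac_class C t s) = frac_class D (\<phi> t) (\<phi> s)" if "(t, s) \<in> tree_pairs C" for t s
    using that theta unfolding tree_pairs_iff by blast
  ultimately show ?thesis by (rule that)
qed

text \<open>
  The hypothesis \<open>cancel\<close> compares two trees in the image after extension by a forest of the target
  that need not be in the image. This asks for more than injectivity of \<open>\<phi>\<close> on trees, which is the
  case of an identity, since the target has no right cancellation in general.
\<close>

lemma frac_hom_injective:
  assumes C: "ore_cat C" and D: "ore_cat D" and phi: "fcat_morphism C D \<phi>"
    and theta: "\<And>t s. (t, s) \<in> tree_pairs C \<Longrightarrow> \<theta> (frac_class C t s) = frac_class D (\<phi> t) (\<phi> s)"
    and cancel: "\<And>t s n k f. arr C 1 n t \<Longrightarrow> arr C 1 n s \<Longrightarrow> arr D n k f \<Longrightarrow>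
       Comp D (\<phi> t) f = Comp D (\<phi> s) f \<Longrightarrow> t = s"
  shows "inj_on \<theta> (carrier (Frac C))"
proof (rule inj_onI)
  interpret C: ore_cat C by fact
  interpret D: ore_cat D by fact
  have arr: "arr D m n (\<phi> f)" if "arr C m n f" for m n f
    using phi that by (simp add: fcat_morphism_def arr_def)
  fix A B assume A: "A \<in> carrier (Frac C)" and B: "B \<in> carrier (Frac C)" and eq: "\<theta> A = \<theta> B"
  obtain m t s where 1: "arr C 1 m t" "arr C 1 m s" "A = frac_class C t s"
    using A by (rule C.carrier_FracE)
  obtain m' t' s' where 2: "arr C 1 m' t'" "arr C 1 m' s'" "B = frac_class C t' s'"
    using B by (rule C.carrier_FracE)
  obtain l p q where pq: "arr C m l p" "arr C m' l q" "Comp C s p = Comp C s' q"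
    using C.common_multiple[OF 1(2) 2(2)] .
  \<comment> \<open>Rewrite both fractions with the same denominator \<open>b\<close>.\<close>
  define a b c where "a = Comp C t p" and "b = Comp C s p" and "c = Comp C t' q"
  have abc: "arr C 1 l a" "arr C 1 l b" "arr C 1 l c"
    unfolding a_def b_def c_def using C.arr_comp[OF 1(1) pq(1)] C.arr_comp[OF 1(2) pq(1)] C.arr_comp[OF 2(1) pq(2)] .
  have AB: "A = frac_class C a b" "B = frac_class C c b"
    using C.frac_class_extend[OF 1(1,2) pq(1)] C.frac_class_extend[OF 2(1,2) pq(2)] 1(3) 2(3) pq(3)
    by (simp_all add: a_def b_def c_def)
  have "frac_class D (\<phi> a) (\<phi> b) = frac_class D (\<phi> c) (\<phi> b)"
    using eq theta abc unfolding AB by (auto simp: tree_pairs_iff)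
  then have "D.common_ext (\<phi> a, \<phi> b) (\<phi> c, \<phi> b)"
    using D.frac_class_eq_iff[OF arr[OF abc(1)] arr[OF abc(2)] arr[OF abc(3)] arr[OF abc(2)]] by simp
  then obtain n n' k f g where 3: "arr D 1 n (\<phi> a)" "arr D 1 n (\<phi> b)" "arr D 1 n' (\<phi> b)" "arr D n k f"
    "arr D n' k g" "Comp D (\<phi> a) f = Comp D (\<phi> c) g" "Comp D (\<phi> b) f = Comp D (\<phi> b) g"
    by (rule D.common_extE)
  have [simp]: "n = l" "n' = l" using 3 arr[OF abc(2)] by (auto simp: arr_def)
  have "f = g" using D.left_cancel[OF 3(2)] 3 by simp
  then have "a = c" using cancel[OF abc(1,3)] 3 by simp
  then show "A = B" using AB by simp
qed

section \<open>Grafting forests\<close>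

lemma fleaves_simps [simp]:
  "fleaves [] = 0" "fleaves (t # f) = nleaves t + fleaves f" "fleaves (f @ g) = fleaves f + fleaves g"
  by (simp_all add: fleaves_def)

lemma fleaves_replicate_Leaf [simp]: "fleaves (replicate n Leaf) = n"
  by (induction n) auto

lemma fleaves_take_drop: "fleaves (take n f) + fleaves (drop n f) = fleaves f"
  by (metis append_take_drop_id fleaves_simps(3))

lemma nleaves_pos [simp]: "0 < nleaves t"
  by (induction t) auto

lemma length_le_fleaves: "length f \<le> fleaves f"
proof (induction f)
  case (Cons t f)
  then show ?case using nleaves_pos[of t] by (simp del: nleaves_pos)
qed simp

lemma length_stack [simp]: "length (stack f g) = length f"
  by (induction f g rule: stack.induct) auto

lemma nleaves_graft: "length g = nleaves t \<Longrightarrow> nleaves (graft t g) = fleaves g"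
proof (induction t arbitrary: g)
  case Leaf
  then show ?case by (cases g) auto
next
  case (Node a l r)
  then show ?case by (simp add: fleaves_take_drop)
qed

lemma fleaves_stack: "length g = fleaves f \<Longrightarrow> fleaves (stack f g) = fleaves g"
proof (induction f arbitrary: g)
  case (Cons t f)
  then show ?case by (simp add: nleaves_graft fleaves_take_drop)
qed simp

lemma stack_append_left:
  "stack (f @ f') g = stack f (take (fleaves f) g) @ stack f' (drop (fleaves f) g)"
proof (induction f arbitrary: g)
  case (Cons t f)
  then show ?case by (simp add: min_def drop_take add.commute)
qed simp

lemma graft_graft:
  "length g = nleaves t \<Longrightarrow> length h = fleaves g \<Longrightarrow> graft (graft t g) h = graft t (stack g h)"
proof (induction t arbitrary: g h)
  case Leaf
  then show ?case by (cases g) auto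
next
  case (Node a l r)
  let ?g1 = "take (nleaves l) g" and ?g2 = "drop (nleaves l) g"
  have len: "length ?g1 = nleaves l" "length ?g2 = nleaves r" using Node.prems by simp_all
  have fl: "fleaves ?g1 + fleaves ?g2 = length h" using Node.prems by (simp add: fleaves_take_drop)
  have "stack g h = stack ?g1 (take (fleaves ?g1) h) @ stack ?g2 (drop (fleaves ?g1) h)"
    using stack_append_left[of ?g1 ?g2 h] by simp
  then have "take (nleaves l) (stack g h) = stack ?g1 (take (fleaves ?g1) h)"
    "drop (nleaves l) (stack g h) = stack ?g2 (drop (fleaves ?g1) h)"
    using len by simp_all
  then show ?case
    using Node.IH(1)[OF len(1), of "take (fleaves ?g1) h"]
      Node.IH(2)[OF len(2), of "drop (fleaves ?g1) h"] fl nleaves_graft[OF len(1)]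
    by simp
qed

lemma stack_assoc:
  "length g = fleaves f \<Longrightarrow> length h = fleaves g \<Longrightarrow> stack (stack f g) h = stack f (stack g h)"
proof (induction f arbitrary: g h)
  case (Cons t f)
  let ?g1 = "take (nleaves t) g" and ?g2 = "drop (nleaves t) g"
  have len: "length ?g1 = nleaves t" "length ?g2 = fleaves f" using Cons.prems by simp_all
  have fl: "fleaves ?g1 + fleaves ?g2 = length h" using Cons.prems by (simp add: fleaves_take_drop)
  have "stack g h = stack ?g1 (take (fleaves ?g1) h) @ stack ?g2 (drop (fleaves ?g1) h)"
    using stack_append_left[of ?g1 ?g2 h] by simp
  then have "take (nleaves t) (stack g h) = stack ?g1 (take (fleaves ?g1) h)"
    "drop (nleaves t) (stack g h) = stack ?g2 (drop (fleaves ?g1) h)"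
    using len by simp_all
  then show ?case
    using graft_graft[OF len(1), of "take (fleaves ?g1) h"]
      Cons.IH[OF len(2), of "drop (fleaves ?g1) h"] fl nleaves_graft[OF len(1)]
    by simp
qed simp

lemma graft_Leaves [simp]: "graft t (replicate (nleaves t) Leaf) = t"
  by (induction t) (simp_all add: take_replicate drop_replicate min_def)

lemma stack_Leaves [simp]: "stack f (replicate (fleaves f) Leaf) = f"
  by (induction f) (simp_all add: take_replicate drop_replicate min_def)

lemma Leaves_stack: "stack (replicate (length f) Leaf) f = f"
  by (induction f) simp_all

lemma forests_over_iff: "f \<in> forests_over S \<longleftrightarrow> set f \<subseteq> trees_over S"
  by (auto simp: forests_over_def in_lists_conv_set)

lemma forests_over_simps [simp]:
  "[] \<in> forests_over S" "t # f \<in> forests_over S \<longleftrightarrow> t \<in> trees_over S \<and> f \<in> forests_over S"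
  "f @ g \<in> forests_over S \<longleftrightarrow> f \<in> forests_over S \<and> g \<in> forests_over S"
  by (auto simp: forests_over_iff)

lemma trees_over_simps [simp]:
  "Leaf \<in> trees_over S"
  "Node a l r \<in> trees_over S \<longleftrightarrow> a \<in> S \<and> l \<in> trees_over S \<and> r \<in> trees_over S"
  by (auto simp: trees_over_def)

lemma forests_over_replicate_Leaf [simp]: "replicate n Leaf \<in> forests_over S"
  by (induction n) auto

lemma forests_over_take [simp]: "f \<in> forests_over S \<Longrightarrow> take n f \<in> forests_over S"
  by (auto simp: forests_over_iff dest: in_set_takeD)

lemma forests_over_drop [simp]: "f \<in> forests_over S \<Longrightarrow> drop n f \<in> forests_over S"
  by (auto simp: forests_over_iff dest: in_set_dropD)

lemma graft_in_trees_over: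
  "t \<in> trees_over S \<Longrightarrow> g \<in> forests_over S \<Longrightarrow> length g = nleaves t \<Longrightarrow> graft t g \<in> trees_over S"
proof (induction t arbitrary: g)
  case Leaf
  then show ?case by (cases g) auto
qed simp

lemma stack_in_forests_over:
  "f \<in> forests_over S \<Longrightarrow> g \<in> forests_over S \<Longrightarrow> length g = fleaves f \<Longrightarrow> stack f g \<in> forests_over S"
  by (induction f arbitrary: g) (simp_all add: graft_in_trees_over)

section \<open>Presented forest-skein categories\<close>

locale presentation =
  fixes S :: "'a set" and R :: "('a ctree \<times> 'a ctree) set"
  assumes presentation: "skein_presentation S R"
begin

text \<open>
  The operations of the category are defined by unions over representatives. Since roots, leaves,
  stacking and concatenation respect \<open>\<approx>\<close>, they can be computed on any representative; this is
  what the rules \<open>Roots_cls\<close> to \<open>Tensor_cls\<close> below say.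
\<close>

abbreviation skein_eq (infix "\<approx>" 50) where "f \<approx> g \<equiv> (f, g) \<in> skein_rel S R"
abbreviation cls where "cls \<equiv> skein_class S R"

lemma skein_rel_invariants:
  "f \<approx> g \<Longrightarrow> f \<in> forests_over S \<and> g \<in> forests_over S \<and> length f = length g \<and> fleaves f = fleaves g"
proof (induction rule: skein_rel.induct)
  case (base t s)
  then show ?case using presentation by (auto simp: skein_presentation_def)
qed (auto simp: stack_in_forests_over fleaves_stack)

lemma equiv_skein_rel: "equiv (forests_over S) (skein_rel S R)"
proof (rule equivI)
  show "skein_rel S R \<subseteq> forests_over S \<times> forests_over S" using skein_rel_invariants by (meson SigmaI subrelI)
  show "refl_on (forests_over S) (skein_rel S R)" by (rule refl_onI) (rule skein_rel.refl)
  show "sym (skein_rel S R)" by (rule symI) (rule skein_rel.sym)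
  show "trans (skein_rel S R)" by (rule transI) (rule skein_rel.trans)
qed

lemma cls_eq_iff: "f \<in> forests_over S \<Longrightarrow> g \<in> forests_over S \<Longrightarrow> cls f = cls g \<longleftrightarrow> f \<approx> g"
  unfolding skein_class_def by (rule eq_equiv_class_iff[OF equiv_skein_rel])

lemma cls_eqI: "f \<approx> g \<Longrightarrow> cls f = cls g"
  using cls_eq_iff skein_rel_invariants by blast

lemma mem_cls: "g \<in> cls f \<longleftrightarrow> f \<approx> g"
  by (simp add: skein_class_def)

lemma skein_rel_append:
  assumes "f \<approx> f'" "g \<approx> g'"
  shows "f @ g \<approx> f' @ g'"
  using skein_rel.tensor_right[OF assms(1)] skein_rel.tensor_left[OF assms(2)]
    skein_rel_invariants[OF assms(1)] skein_rel_invariants[OF assms(2)] skein_rel.trans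
  by blast

lemma skein_rel_stack:
  assumes "f \<approx> f'" "g \<approx> g'" "length g = fleaves f"
  shows "stack f g \<approx> stack f' g'"
proof (rule skein_rel.trans)
  show "stack f g \<approx> stack f' g" "stack f' g \<approx> stack f' g'"
    using assms skein_rel_invariants[OF assms(1)] skein_rel_invariants[OF assms(2)]
    by (auto intro: skein_rel.stack_left skein_rel.stack_right)
qed

lemma skein_rel_if_components:
  "list_all2 (\<lambda>t s. [t] \<approx> [s]) f g \<Longrightarrow> f \<approx> g"
proof (induction rule: list_all2_induct)
  case Nil
  show ?case by (simp add: skein_rel.refl)
next
  case (Cons t f s g)
  then show ?case using skein_rel_append[of "[t]" "[s]" f g] by simp
qed

lemma components_refl: "f \<in> forests_over S \<Longrightarrow> list_all2 (\<lambda>t s. [t] \<approx> [s]) f f"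
  by (induction f) (simp_all add: skein_rel.refl)

text \<open>
  A relation between trees affects one tree at a time, so the congruence it generates on
  forests never mixes the trees of a forest. Together with \<open>skein_rel_if_components\<close> this says that
  the category has unique tensor decomposition into trees.
\<close>

lemma components_if_skein_rel:
  "f \<approx> g \<Longrightarrow> list_all2 (\<lambda>t s. [t] \<approx> [s]) f g"
proof (induction rule: skein_rel.induct)
  case (base t s)
  then show ?case by (simp add: skein_rel.base)
next
  case (refl f)
  then show ?case by (rule components_refl)
next
  case (sym f g)
  then show ?case by (simp add: list_all2_conv_all_nth skein_rel.sym)
next
  case (trans f g h)
  show ?case by (rule list_all2_trans[OF _ trans.IH]) (rule skein_rel.trans)
next
  case (stack_left f g h)
  from stack_left.IH stack_left.hyps(2,3) show ?case
  proof (induction h arbitrary: f g)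
    case (Cons t h)
    have "take (nleaves t) f \<approx> take (nleaves t) g"
      using Cons.prems(1) by (intro skein_rel_if_components list_all2_takeI)
    then have "stack [t] (take (nleaves t) f) \<approx> stack [t] (take (nleaves t) g)"
      using Cons.prems list_all2_lengthD[OF Cons.prems(1)] by (intro skein_rel.stack_left) simp_all
    moreover have "list_all2 (\<lambda>t s. [t] \<approx> [s]) (stack h (drop (nleaves t) f)) (stack h (drop (nleaves t) g))"
      using Cons.prems by (intro Cons.IH list_all2_dropI) simp_all
    ultimately show ?case by simp
  qed simp
next
  case (stack_right f g h)
  from stack_right.IH stack_right.hyps(2,3) show ?case
  proof (induction arbitrary: h rule: list_all2_induct)
    case (Cons t f s g)
    have "nleaves t = nleaves s" using skein_rel_invariants[OF Cons(1)] by simp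
    moreover have "stack [t] (take (nleaves t) h) \<approx> stack [s] (take (nleaves t) h)"
      using Cons.hyps Cons.prems by (intro skein_rel.stack_right) simp_all
    ultimately show ?case using Cons.IH[of "drop (nleaves t) h"] Cons.prems by simp
  qed simp
next
  case (tensor_left f g h)
  then show ?case by (simp add: list_all2_appendI components_refl)
next
  case (tensor_right f g h)
  then show ?case by (simp add: list_all2_appendI components_refl)
qed

lemma Roots_cls: "f \<in> forests_over S \<Longrightarrow> Roots (ForC S R) (cls f) = length f"
proof -
  assume f: "f \<in> forests_over S"
  have "length ` cls f = {length f}"
    using skein_rel.refl[OF f] skein_rel_invariants by (fastforce simp: mem_cls)
  then show ?thesis by (simp add: ForC_def)
qed

lemma Leaves_cls: "f \<in> forests_over S \<Longrightarrow> Leaves (ForC S R) (cls f) = fleaves f"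
proof -
  assume f: "f \<in> forests_over S"
  have "fleaves ` cls f = {fleaves f}"
    using skein_rel.refl[OF f] skein_rel_invariants by (fastforce simp: mem_cls)
  then show ?thesis by (simp add: ForC_def)
qed

lemma cls_in_Mor: "f \<in> forests_over S \<Longrightarrow> cls f \<in> Mor (ForC S R)"
  by (simp add: ForC_def skein_class_def quotientI)

lemma Mor_cases:
  assumes "A \<in> Mor (ForC S R)"
  obtains f where "f \<in> forests_over S" "A = cls f"
  using assms by (auto simp: ForC_def skein_class_def elim: quotientE)

lemma arr_ForC_iff:
  "arr (ForC S R) m n A \<longleftrightarrow> (\<exists>f\<in>forests_over S. A = cls f \<and> length f = m \<and> fleaves f = n)"
proof
  assume A: "arr (ForC S R) m n A"
  then obtain f where "f \<in> forests_over S" "A = cls f" unfolding arr_def by (blast elim: Mor_cases)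
  then show "\<exists>f\<in>forests_over S. A = cls f \<and> length f = m \<and> fleaves f = n"
    using A by (auto simp: arr_def Roots_cls Leaves_cls)
qed (auto simp: arr_def Roots_cls Leaves_cls cls_in_Mor)

lemma Comp_cls:
  assumes "f \<in> forests_over S" "g \<in> forests_over S" "length g = fleaves f"
  shows "Comp (ForC S R) (cls f) (cls g) = cls (stack f g)"
proof -
  have "cls (stack f' g') = cls (stack f g)" if "f' \<in> cls f" "g' \<in> cls g" for f' g'
    using that assms(3) by (metis cls_eqI mem_cls skein_rel_stack)
  moreover have "f \<in> cls f" "g \<in> cls g" using assms by (auto simp: mem_cls intro: skein_rel.refl)
  ultimately have "(\<Union>f'\<in>cls f. \<Union>g'\<in>cls g. cls (stack f' g')) = cls (stack f g)" by blast
  then show ?thesis by (simp add: ForC_def)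
qed

lemma Tensor_cls:
  assumes "f \<in> forests_over S" "g \<in> forests_over S"
  shows "Tensor (ForC S R) (cls f) (cls g) = cls (f @ g)"
proof -
  have "cls (f' @ g') = cls (f @ g)" if "f' \<in> cls f" "g' \<in> cls g" for f' g'
    using that by (metis cls_eqI mem_cls skein_rel_append)
  moreover have "f \<in> cls f" "g \<in> cls g" using assms by (auto simp: mem_cls intro: skein_rel.refl)
  ultimately have "(\<Union>f'\<in>cls f. \<Union>g'\<in>cls g. cls (f' @ g')) = cls (f @ g)" by blast
  then show ?thesis by (simp add: ForC_def)
qed

lemma ore_cat_ForC:
  assumes "ore_category (ForC S R)"
  shows "ore_cat (ForC S R)"
proof
  show "arr (ForC S R) m k (Comp (ForC S R) A B)"
    if "arr (ForC S R) m n A" "arr (ForC S R) n k B" for m n k A B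
    using that by (auto simp: arr_ForC_iff Comp_cls stack_in_forests_over fleaves_stack)
  show "Comp (ForC S R) (Comp (ForC S R) A B) D = Comp (ForC S R) A (Comp (ForC S R) B D)"
    if "arr (ForC S R) m n A" "arr (ForC S R) n k B" "arr (ForC S R) k l D" for m n k l A B D
    using that by (auto simp: arr_ForC_iff Comp_cls stack_in_forests_over fleaves_stack stack_assoc)
  show "arr (ForC S R) n n (Ident (ForC S R) n)" for n
    unfolding arr_ForC_iff by (rule bexI[of _ "replicate n Leaf"]) (simp_all add: ForC_def)
  have ident: "Ident (ForC S R) n = cls (replicate n Leaf)" for n by (simp add: ForC_def)
  show "Comp (ForC S R) (Ident (ForC S R) m) A = A" if "arr (ForC S R) m n A" for m n A
    using that by (auto simp: arr_ForC_iff ident Comp_cls Leaves_stack)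
  show "Comp (ForC S R) A (Ident (ForC S R) n) = A" if "arr (ForC S R) m n A" for m n A
    using that by (auto simp: arr_ForC_iff ident Comp_cls)
qed (rule assms)

lemma skein_rel_left_cancel:
  assumes "left_cancellative (ForC S R)" and "f \<in> forests_over S" "g \<in> forests_over S"
    "h \<in> forests_over S" "length g = fleaves f" "length h = fleaves f" "stack f g \<approx> stack f h"
  shows "g \<approx> h"
proof -
  have "Comp (ForC S R) (cls f) (cls g) = Comp (ForC S R) (cls f) (cls h)"
    using assms by (simp add: Comp_cls cls_eqI)
  moreover have "Leaves (ForC S R) (cls f) = Roots (ForC S R) (cls g)"
    "Leaves (ForC S R) (cls f) = Roots (ForC S R) (cls h)"
    using assms by (simp_all add: Leaves_cls Roots_cls)
  ultimately have "cls g = cls h"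
    using assms(1)[unfolded left_cancellative_def] cls_in_Mor[OF assms(2)] cls_in_Mor[OF assms(3)]
      cls_in_Mor[OF assms(4)] by blast
  then show ?thesis using assms by (simp add: cls_eq_iff)
qed

end

section \<open>The free monochromatic category\<close>

lemma skein_rel_free: "(f, g) \<in> skein_rel S {} \<Longrightarrow> f = g"
  by (induction rule: skein_rel.induct) auto

lemma graft_left_inj:
  "length g = nleaves t \<Longrightarrow> length h = nleaves t \<Longrightarrow> graft t g = graft t h \<Longrightarrow> g = h"
proof (induction t arbitrary: g h)
  case Leaf
  then show ?case by (cases g; cases h) auto
next
  case (Node a l r)
  have "take (nleaves l) g = take (nleaves l) h" "drop (nleaves l) g = drop (nleaves l) h"
    using Node by simp_all
  then show ?case by (metis append_take_drop_id)
qed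

lemma stack_left_inj:
  "length g = fleaves f \<Longrightarrow> length h = fleaves f \<Longrightarrow> stack f g = stack f h \<Longrightarrow> g = h"
proof (induction f arbitrary: g h)
  case (Cons t f)
  have "take (nleaves t) g = take (nleaves t) h"
    using Cons.prems by (intro graft_left_inj[of _ t]) simp_all
  moreover have "drop (nleaves t) g = drop (nleaves t) h"
    using Cons by simp
  ultimately show ?case by (metis append_take_drop_id)
qed simp

text \<open>
  The common refinement of two binary trees: grow both until their shapes agree, recursively on the
  left and right subtrees. A single colour is essential, since the root colours must match.
\<close>

lemma common_grafting:
  fixes t s :: "unit ctree"
  shows "\<exists>p q. length p = nleaves t \<and> length q = nleaves s \<and> graft t p = graft s q"
proof (induction t arbitrary: s)
  case Leaf
  show ?case by (rule exI[of _ "[s]"], rule exI[of _ "replicate (nleaves s) Leaf"]) simp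
next
  case (Node u l r)
  show ?case
  proof (cases s)
    case Leaf
    then show ?thesis
      by (intro exI[of _ "replicate (nleaves (Node u l r)) Leaf"] exI[of _ "[Node u l r]"])
        (simp add: take_replicate drop_replicate min_def)
  next
    case (Node v l' r')
    obtain p q where 1: "length p = nleaves l" "length q = nleaves l'" "graft l p = graft l' q"
      using Node.IH(1) by blast
    obtain p' q' where 2: "length p' = nleaves r" "length q' = nleaves r'" "graft r p' = graft r' q'"
      using Node.IH(2) by blast
    show ?thesis
      by (rule exI[of _ "p @ p'"], rule exI[of _ "q @ q'"]) (use 1 2 Node in simp)
  qed
qed

lemma common_stacking:
  fixes f g :: "unit cforest"
  shows "length f = length g \<Longrightarrow>
    \<exists>p q. length p = fleaves f \<and> length q = fleaves g \<and> stack f p = stack g q"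
proof (induction f g rule: list_induct2)
  case (Cons t f s g)
  obtain p q where 1: "length p = nleaves t" "length q = nleaves s" "graft t p = graft s q"
    using common_grafting by blast
  obtain p' q' where 2: "length p' = fleaves f" "length q' = fleaves g" "stack f p' = stack g q'"
    using Cons by blast
  show ?case
    by (rule exI[of _ "p @ p'"], rule exI[of _ "q @ q'"]) (use 1 2 in simp)
qed simp

lemma forests_over_unit [simp]: "(f :: unit cforest) \<in> forests_over {()}"
  by (auto simp: forests_over_iff trees_over_def)

interpretation UF: presentation "{()}" "{}"
  rewrites "ForC {()} {} = UF"
  by unfold_locales (simp_all add: skein_presentation_def UF_def)

lemma UF_cls_inject: "UF.cls f = UF.cls g \<longleftrightarrow> f = g"
  using UF.cls_eq_iff[of f g] skein_rel_free by auto

lemma ore_category_UF: "ore_category UF"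
  unfolding ore_category_def left_cancellative_def
proof (intro conjI ballI impI)
  fix A B D assume "A \<in> Mor UF" "B \<in> Mor UF" "D \<in> Mor UF"
    and *: "Leaves UF A = Roots UF B \<and> Leaves UF A = Roots UF D \<and> Comp UF A B = Comp UF A D"
  then obtain f g h where "A = UF.cls f" "B = UF.cls g" "D = UF.cls h"
    by (metis UF.Mor_cases)
  with * show "B = D"
    using stack_left_inj[of g f h]
    by (auto simp: UF.Leaves_cls UF.Roots_cls UF.Comp_cls UF_cls_inject)
next
  fix A B assume "A \<in> Mor UF" "B \<in> Mor UF" and *: "Roots UF A = Roots UF B"
  then obtain f g where fg: "A = UF.cls f" "B = UF.cls g"
    by (metis UF.Mor_cases)
  then have "length f = length g" using * by (simp add: UF.Roots_cls)
  then obtain p q where "length p = fleaves f" "length q = fleaves g" "stack f p = stack g q"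
    using common_stacking by blast
  then show "\<exists>P\<in>Mor UF. \<exists>Q\<in>Mor UF. Leaves UF A = Roots UF P \<and> Leaves UF B = Roots UF Q \<and>
      Comp UF A P = Comp UF B Q"
    unfolding fg
    by (intro bexI[of _ "UF.cls p"] bexI[of _ "UF.cls q"])
      (simp_all add: UF.Leaves_cls UF.Roots_cls UF.Comp_cls UF.cls_in_Mor)
qed

lemma ore_cat_UF: "ore_cat UF"
  using UF.ore_cat_ForC ore_category_UF by blast

section \<open>Colouring\<close>

abbreviation colour_tree :: "'a \<Rightarrow> unit ctree \<Rightarrow> 'a ctree" where
  "colour_tree a \<equiv> map_ctree (\<lambda>_. a)"

lemma nleaves_map_ctree [simp]: "nleaves (map_ctree c t) = nleaves t"
  by (induction t) auto

lemma fleaves_map_ctree [simp]: "fleaves (map (map_ctree c) f) = fleaves f"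
  by (induction f) auto

lemma map_ctree_graft:
  "length g = nleaves t \<Longrightarrow> map_ctree c (graft t g) = graft (map_ctree c t) (map (map_ctree c) g)"
proof (induction t arbitrary: g)
  case Leaf
  then show ?case by (cases g) auto
qed (simp add: take_map drop_map)

lemma map_ctree_stack:
  "length g = fleaves f \<Longrightarrow>
    map (map_ctree c) (stack f g) = stack (map (map_ctree c) f) (map (map_ctree c) g)"
  by (induction f arbitrary: g) (simp_all add: map_ctree_graft take_map drop_map)

lemma colour_tree_over: "a \<in> S \<Longrightarrow> colour_tree a t \<in> trees_over S"
  by (induction t) auto

lemma colour_forest_over: "a \<in> S \<Longrightarrow> map (colour_tree a) f \<in> forests_over S"
  by (induction f) (auto simp: colour_tree_over)

lemma fleaves_take_inject:
  assumes "fleaves (take m f) = fleaves (take n f)" "m \<le> length f" "n \<le> length f"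
  shows "m = n"
proof -
  have "fleaves (take i f) < fleaves (take j f)" if "i < j" "j \<le> length f" for i j
  proof -
    have "take j f = take i f @ take (j - i) (drop i f)"
      using that by (metis le_add_diff_inverse less_imp_le take_add)
    moreover have "0 < length (take (j - i) (drop i f))" using that by simp
    ultimately show ?thesis
      using length_le_fleaves[of "take (j - i) (drop i f)"] fleaves_simps(3) by (metis less_add_same_cancel1 less_le_trans)
  qed
  then show ?thesis using assms by (metis less_irrefl linorder_neqE_nat)
qed

lemma nleaves_eq_1: "nleaves t = 1 \<longleftrightarrow> t = Leaf"
proof (cases t)
  case (Node a l r)
  then show ?thesis using nleaves_pos[of l] nleaves_pos[of r] by (simp del: nleaves_pos)
qed simp

context presentation
begin

text \<open>
  The right cancellation property on which everything rests. The forest \<open>f\<close> is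
  arbitrary over \<open>S\<close> and not monochromatic, because it comes from an equality of fractions in the
  target.
\<close>

lemma colour_tree_cancel:
  assumes "left_cancellative (ForC S R)" "a \<in> S"
  shows "nleaves t = nleaves s \<Longrightarrow> length f = nleaves t \<Longrightarrow> f \<in> forests_over S \<Longrightarrow>
    [graft (colour_tree a t) f] \<approx> [graft (colour_tree a s) f] \<Longrightarrow> t = s"
proof (induction t arbitrary: s f)
  case Leaf
  then show ?case using nleaves_eq_1[of s] by simp
next
  case (Node u l r)
  then obtain v l' r' where s: "s = Node v l' r'"
    using nleaves_eq_1[of "Node u l r"] by (cases s) auto
  let ?sub = "\<lambda>l r. [graft (colour_tree a l) (take (nleaves l) f), graft (colour_tree a r) (drop (nleaves l) f)]"
  have over: "?sub l r \<in> forests_over S" "?sub l' r' \<in> forests_over S"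
    using Node.prems s assms(2) by (auto intro!: graft_in_trees_over colour_tree_over)
  have "stack [Node a Leaf Leaf] (?sub l r) \<approx> stack [Node a Leaf Leaf] (?sub l' r')"
    using Node.prems(4) s by simp
  then have "?sub l r \<approx> ?sub l' r'"
    by (rule skein_rel_left_cancel[OF assms(1) _ over, rotated -1]) (use assms(2) in simp_all)
  then have left: "[graft (colour_tree a l) (take (nleaves l) f)] \<approx> [graft (colour_tree a l') (take (nleaves l') f)]"
    and right: "[graft (colour_tree a r) (drop (nleaves l) f)] \<approx> [graft (colour_tree a r') (drop (nleaves l') f)]"
    by (auto dest: components_if_skein_rel)
  \<comment> \<open>A priori the two root carets may split \<open>f\<close> at different places; counting leaves excludes this.\<close>
  have "fleaves (take (nleaves l) f) = fleaves (take (nleaves l') f)"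
    using skein_rel_invariants[OF left] Node.prems s by (simp add: nleaves_graft)
  then have n: "nleaves l = nleaves l'"
    by (rule fleaves_take_inject) (use Node.prems s in auto)
  have "l = l'"
    using Node.IH(1)[of l' "take (nleaves l) f"] left n Node.prems by simp
  moreover have "r = r'"
    using Node.IH(2)[of r' "drop (nleaves l) f"] right n Node.prems s by simp
  ultimately show ?case using s by simp
qed

lemma colour_forest_cancel:
  assumes "left_cancellative (ForC S R)" "a \<in> S"
    and "map (colour_tree a) f \<approx> map (colour_tree a) g"
  shows "f = g"
proof -
  have comp: "list_all2 (\<lambda>t s. [colour_tree a t] \<approx> [colour_tree a s]) f g"
    using components_if_skein_rel[OF assms(3)] by (simp add: list_all2_map1 list_all2_map2)
  have "t = s" if "[colour_tree a t] \<approx> [colour_tree a s]" for t s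
  proof -
    have n: "nleaves t = nleaves s" using skein_rel_invariants[OF that] by simp
    have "graft (colour_tree a t) (replicate (nleaves t) Leaf) = colour_tree a t"
      "graft (colour_tree a s) (replicate (nleaves t) Leaf) = colour_tree a s"
      using graft_Leaves[of "colour_tree a t"] graft_Leaves[of "colour_tree a s"] n by simp_all
    then show ?thesis
      using colour_tree_cancel[OF assms(1,2) n, of "replicate (nleaves t) Leaf"] that by simp
  qed
  then show ?thesis using list_all2_mono[OF comp, of "(=)"] by (simp add: list.rel_eq)
qed

lemma colouring_map_cls: "colouring_map S R a (UF.cls f) = cls (map (colour_tree a) f)"
proof -
  have "UF.cls f = {f}"
    using skein_rel.refl[OF forests_over_unit, of f]
    by (auto simp: UF.mem_cls dest: skein_rel_free)
  then show ?thesis by (simp add: colouring_map_def)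
qed

lemma UF_Y_cls: "UF_Y = UF.cls [Node () Leaf Leaf]"
  by (simp add: UF_Y_def caret_def)

lemma colouring_map_Y: "colouring_map S R a UF_Y = caret S R a"
  by (simp add: UF_Y_cls colouring_map_cls caret_def)

lemma fcat_morphism_colouring_map:
  assumes "a \<in> S"
  shows "fcat_morphism UF (ForC S R) (colouring_map S R a)"
proof -
  note [simp] = colour_forest_over[OF assms] colouring_map_cls Roots_cls Leaves_cls UF.Roots_cls
    UF.Leaves_cls
  show ?thesis
    unfolding fcat_morphism_def
    by (auto elim!: UF.Mor_cases simp: cls_in_Mor UF.Comp_cls Comp_cls UF.Tensor_cls Tensor_cls
        map_ctree_stack)
qed

text \<open>
  Stacking and concatenation generate all forests from the caret, the trivial tree and the empty
  forest. The images of the last two are forced by their numbers of roots and leaves.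
\<close>

lemma colouring_map_unique:
  assumes "a \<in> S" and C: "fcat_morphism UF (ForC S R) C" and Y: "C UF_Y = caret S R a"
    and "A \<in> Mor UF"
  shows "C A = colouring_map S R a A"
proof -
  have arr: "arr (ForC S R) (length f) (fleaves f) (C (UF.cls f))" for f
    using C UF.cls_in_Mor[of f]
    by (simp add: fcat_morphism_def arr_def UF.Roots_cls UF.Leaves_cls)
  have comp: "C (UF.cls (stack f g)) = Comp (ForC S R) (C (UF.cls f)) (C (UF.cls g))"
    if "length g = fleaves f" for f g
  proof -
    have "Leaves UF (UF.cls f) = Roots UF (UF.cls g)"
      using that by (simp add: UF.Roots_cls UF.Leaves_cls)
    then show ?thesis
      using C UF.cls_in_Mor[of f] UF.cls_in_Mor[of g] UF.Comp_cls[of f g] that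
      unfolding fcat_morphism_def by (metis forests_over_unit)
  qed
  have tensor: "C (UF.cls (f @ g)) = Tensor (ForC S R) (C (UF.cls f)) (C (UF.cls g))" for f g
    using C UF.cls_in_Mor[of f] UF.cls_in_Mor[of g] UF.Tensor_cls[of f g]
    unfolding fcat_morphism_def by (metis forests_over_unit)
  note over = colour_tree_over[OF assms(1)] colour_forest_over[OF assms(1)]
  have tree: "C (UF.cls [t]) = cls [colour_tree a t]" for t
  proof (induction t)
    case Leaf
    obtain f where f: "C (UF.cls [Leaf]) = cls f" "length f = 1" "fleaves f = 1"
      using arr[of "[Leaf]"] unfolding arr_ForC_iff by auto
    then obtain t where "f = [t]" by (auto simp: length_Suc_conv)
    with f nleaves_eq_1[of t] show ?case by simp
  next
    case (Node u l r)
    have "C (UF.cls [l, r]) = cls [colour_tree a l, colour_tree a r]"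
      using tensor[of "[l]" "[r]"] Node.IH by (simp add: Tensor_cls over)
    moreover have "[Node u l r] = stack [Node () Leaf Leaf] [l, r]" by simp
    ultimately have "C (UF.cls [Node u l r]) =
        Comp (ForC S R) (cls [Node a Leaf Leaf]) (cls [colour_tree a l, colour_tree a r])"
      using comp[of "[l, r]" "[Node () Leaf Leaf]"] Y by (simp add: UF_Y_cls caret_def)
    then show ?case using assms(1) by (simp add: Comp_cls over)
  qed
  have forest: "C (UF.cls f) = cls (map (colour_tree a) f)" for f
  proof (induction f)
    case Nil
    show ?case using arr[of "[]"] by (auto simp: arr_ForC_iff)
  next
    case (Cons t f)
    then show ?case using tensor[of "[t]" f] tree[of t] by (simp add: Tensor_cls over)
  qed
  obtain f where "A = UF.cls f" using assms(4) by (rule UF.Mor_cases)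
  then show ?thesis by (simp add: forest colouring_map_cls)
qed

lemma inj_on_colouring_map:
  assumes "left_cancellative (ForC S R)" "a \<in> S"
  shows "inj_on (colouring_map S R a) (Mor UF)"
proof (rule inj_onI)
  fix A B assume "A \<in> Mor UF" "B \<in> Mor UF" and eq: "colouring_map S R a A = colouring_map S R a B"
  then obtain f g where fg: "A = UF.cls f" "B = UF.cls g" by (metis UF.Mor_cases)
  have "map (colour_tree a) f \<approx> map (colour_tree a) g"
    using eq colour_forest_over[OF assms(2)] by (simp add: fg colouring_map_cls cls_eq_iff)
  then show "A = B" using colour_forest_cancel[OF assms] fg by blast
qed

lemma thompson_F_embeds:
  assumes ore: "ore_category (ForC S R)" and a: "a \<in> S"
  shows "\<exists>\<theta>. group_hom thompson_F (Frac (ForC S R)) \<theta> \<and> inj_on \<theta> (carrier thompson_F) \<and>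
    (\<forall>(t, s) \<in> tree_pairs UF. \<theta> (frac_class UF t s) =
       frac_class (ForC S R) (colouring_map S R a t) (colouring_map S R a s))"
proof -
  have lc: "left_cancellative (ForC S R)" using ore by (simp add: ore_category_def)
  note morphism = fcat_morphism_colouring_map[OF a]
  obtain \<theta> where hom: "group_hom (Frac UF) (Frac (ForC S R)) \<theta>"
    and val: "\<And>t s. (t, s) \<in> tree_pairs UF \<Longrightarrow>
      \<theta> (frac_class UF t s) = frac_class (ForC S R) (colouring_map S R a t) (colouring_map S R a s)"
    by (rule frac_hom[OF ore_cat_UF ore_cat_ForC[OF ore] morphism]) blast
  have "inj_on \<theta> (carrier (Frac UF))"
  proof (rule frac_hom_injective[OF ore_cat_UF ore_cat_ForC[OF ore] morphism val])
    fix A B D n k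
    assume "arr UF 1 n A" "arr UF 1 n B" "arr (ForC S R) n k D"
      and eq: "Comp (ForC S R) (colouring_map S R a A) D = Comp (ForC S R) (colouring_map S R a B) D"
    then obtain f g h where fg: "A = UF.cls f" "length f = 1" "fleaves f = n"
      "B = UF.cls g" "length g = 1" "fleaves g = n"
      and h: "D = cls h" "h \<in> forests_over S" "length h = n"
      unfolding UF.arr_ForC_iff arr_ForC_iff by blast
    from fg obtain t s where ts: "f = [t]" "g = [s]" by (auto simp: length_Suc_conv)
    have rel: "[graft (colour_tree a t) h] \<approx> [graft (colour_tree a s) h]"
      using eq fg h ts
      by (simp add: colouring_map_cls Comp_cls colour_tree_over[OF a] cls_eq_iff graft_in_trees_over)
    have "nleaves t = nleaves s" "length h = nleaves t"
      using fg(3,6) h(3) unfolding ts by simp_all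
    then have "t = s" by (rule colour_tree_cancel[OF lc a _ _ h(2) rel])
    then show "A = B" unfolding fg(1,4) ts by simp
  qed
  then show ?thesis using hom val unfolding thompson_F_def by blast
qed

end

theorem corollary3p9:
  shows "(\<forall>H :: ('h, 'm) monoid_scheme. forest_skein_group TYPE('a) H \<longrightarrow>
            (\<exists>\<theta>. group_hom thompson_F H \<theta> \<and> inj_on \<theta> (carrier thompson_F))) \<and>
         (\<forall>(S :: 'a set) R. skein_presentation S R \<and> ore_category (ForC S R) \<longrightarrow>
            (\<forall>a\<in>S.
               fcat_morphism UF (ForC S R) (colouring_map S R a) \<and>
               colouring_map S R a UF_Y = caret S R a \<and>
               (\<forall>C. fcat_morphism UF (ForC S R) C \<and> C UF_Y = caret S R a \<longrightarrow>
                    (\<forall>f\<in>Mor UF. C f = colouring_map S R a f)) \<and>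
               inj_on (colouring_map S R a) (Mor UF) \<and>
               (\<exists>\<theta>. group_hom thompson_F (Frac (ForC S R)) \<theta> \<and>
                    inj_on \<theta> (carrier thompson_F) \<and>
                    (\<forall>(t, s) \<in> tree_pairs UF.
                       \<theta> (frac_class UF t s) =
                       frac_class (ForC S R) (colouring_map S R a t) (colouring_map S R a s)))))"
proof (intro conjI allI impI ballI)
  fix H :: "('h, 'm) monoid_scheme"
  assume "forest_skein_group TYPE('a) H"
  then have H: "group H"
    and ex: "\<exists>(S :: 'a set) R. skein_presentation S R \<and> ore_category (ForC S R) \<and> Frac (ForC S R) \<cong> H"
    by (simp_all add: forest_skein_group_def)
  from ex obtain S :: "'a set" and R where pres: "skein_presentation S R"
    and ore: "ore_category (ForC S R)" and iso: "Frac (ForC S R) \<cong> H"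
    by (elim exE conjE)
  obtain h where h: "h \<in> iso (Frac (ForC S R)) H" using iso by (auto simp: is_iso_def)
  interpret presentation S R using pres by unfold_locales
  obtain a where "a \<in> S" using pres by (auto simp: skein_presentation_def)
  then obtain \<theta> where \<theta>: "group_hom thompson_F (Frac (ForC S R)) \<theta>" "inj_on \<theta> (carrier thompson_F)"
    using thompson_F_embeds[OF ore] by blast
  have hom: "\<theta> \<in> hom thompson_F (Frac (ForC S R))" and F: "group thompson_F"
    using \<theta>(1) by (simp_all add: group_hom_def group_hom_axioms_def)
  have "h \<in> hom (Frac (ForC S R)) H" and inj: "inj_on h (carrier (Frac (ForC S R)))"
    using h by (auto simp: iso_def bij_betw_def)
  then have "h \<circ> \<theta> \<in> hom thompson_F H" using hom hom_compose by blast
  then have "group_hom thompson_F H (h \<circ> \<theta>)"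
    by (intro group_hom.intro group_hom_axioms.intro F H)
  moreover have "inj_on (h \<circ> \<theta>) (carrier thompson_F)"
    using \<theta>(2) inj hom by (intro comp_inj_on inj_on_subset[OF inj]) (auto simp: hom_def)
  ultimately show "\<exists>\<theta>. group_hom thompson_F H \<theta> \<and> inj_on \<theta> (carrier thompson_F)" by blast
next
  fix S :: "'a set" and R a
  assume *: "skein_presentation S R \<and> ore_category (ForC S R)" and a: "a \<in> S"
  then interpret presentation S R by unfold_locales simp
  show "fcat_morphism UF (ForC S R) (colouring_map S R a)"
    using a by (rule fcat_morphism_colouring_map)
  show "colouring_map S R a UF_Y = caret S R a" by (rule colouring_map_Y)
  show "C f = colouring_map S R a f"
    if "fcat_morphism UF (ForC S R) C \<and> C UF_Y = caret S R a" "f \<in> Mor UF" for C f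
    using colouring_map_unique a that by blast
  show "inj_on (colouring_map S R a) (Mor UF)"
    using * a by (simp add: inj_on_colouring_map ore_category_def)
  show "\<exists>\<theta>. group_hom thompson_F (Frac (ForC S R)) \<theta> \<and> inj_on \<theta> (carrier thompson_F) \<and>
    (\<forall>(t, s) \<in> tree_pairs UF. \<theta> (frac_class UF t s) =
       frac_class (ForC S R) (colouring_map S R a t) (colouring_map S R a s))"
    using * a by (intro thompson_F_embeds) simp_all
qed

end
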